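(* Let $d\ge 1$ be an integer, and let $n_1,\ldots,n_d\ge 2$ be integers with $2n_1\le\cdots\le 2n_d$ such that the even discrete torus $C_{2n_1}\square\cdots\square C_{2n_d}$ is exceptional, that is, $n_1=2$ and $2n_i\equiv 2\pmod 4$ for $i=2,\ldots,d$. Then \[ q_B(C_{2n_1}\square\cdots\square C_{2n_d})= \begin{cases} 4,&d=1,\\ 5,&d=2,\\ 2d,&d\ge 3. \end{cases} \]
   Context: All graphs are finite and simple. An edge-coloring is proper if incident (i.e. sharing an endpoint) distinct edges receive distinct colors. A set of edges is rainbow if its edges have pairwise distinct colors. A B-coloring of a graph $G$ is a proper edge-coloring of $G$ in which every $4$-cycle (cycle subgraph of length $4$, not necessarily induced) is rainbow. The B-coloring number $q_B(G)$ is the minimum number of colors in a B-coloring of $G$. $C_n$ denotes the cycle on $n$ vertices. The Cartesian product $G\square H$ has vertex set $V(G)\times V(H)$, with $(u,x)$ adjacent to $(v,y)$ if and only if $uv\in E(G)$ and $x=y$, or $u=v$ and $xy\in E(H)$. A product of cycles is called a discrete torus, and it is even when every factor has even length. *)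

theory Defs
  imports Main "HOL-Number_Theory.Cong"
begin

datatype 'a graph = Graph (verts: "'a set") (edges: "'a set set")

definition simple_graph :: "'a graph \<Rightarrow> bool" where
  "simple_graph G \<longleftrightarrow>
     finite (verts G) \<and> (\<forall>e\<in>edges G. e \<subseteq> verts G \<and> card e = 2)"

definition proper_edge_coloring :: "'a graph \<Rightarrow> ('a set \<Rightarrow> 'c) \<Rightarrow> bool" where
  "proper_edge_coloring G c \<longleftrightarrow>
     (\<forall>e\<in>edges G. \<forall>f\<in>edges G. e \<noteq> f \<and> e \<inter> f \<noteq> {} \<longrightarrow> c e \<noteq> c f)"

definition rainbow :: "('a set \<Rightarrow> 'c) \<Rightarrow> 'a set set \<Rightarrow> bool" where
  "rainbow c F \<longleftrightarrow> inj_on c F"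

text \<open>A 4-cycle is represented by its set of edges.\<close>

definition is_four_cycle :: "'a graph \<Rightarrow> 'a set set \<Rightarrow> bool" where
  "is_four_cycle G F \<longleftrightarrow>
     (\<exists>u v w x. distinct [u, v, w, x] \<and>
        F = {{u, v}, {v, w}, {w, x}, {x, u}} \<and> F \<subseteq> edges G)"

definition B_coloring :: "'a graph \<Rightarrow> ('a set \<Rightarrow> 'c) \<Rightarrow> bool" where
  "B_coloring G c \<longleftrightarrow>
     proper_edge_coloring G c \<and> (\<forall>F. is_four_cycle G F \<longrightarrow> rainbow c F)"

text \<open>
  Colors are natural numbers, and only the colors attained on edges of the graph are counted.
  The set over which the minimum is taken is nonempty for every simple graph; see
  \<open>q_B_attained\<close> below.
\<close>

definition q_B :: "'a graph \<Rightarrow> nat" where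
  "q_B G = (LEAST k. \<exists>c :: 'a set \<Rightarrow> nat. B_coloring G c \<and> card (c ` edges G) = k)"

text \<open>The definition yields a cycle only for \<open>n \<ge> 3\<close>.\<close>

definition cycle_graph :: "nat \<Rightarrow> nat graph" where
  "cycle_graph n = Graph {0..<n} {{i, (i + 1) mod n} | i. i < n}"

definition cart_prod :: "'a graph \<Rightarrow> 'b graph \<Rightarrow> ('a \<times> 'b) graph" where
  "cart_prod G H = Graph (verts G \<times> verts H)
     {{(u, x), (v, y)} | u x v y.
        u \<in> verts G \<and> v \<in> verts G \<and> x \<in> verts H \<and> y \<in> verts H \<and>
        ({u, v} \<in> edges G \<and> x = y \<or> u = v \<and> {x, y} \<in> edges H)}"

definition relabel :: "('a \<Rightarrow> 'b) \<Rightarrow> 'a graph \<Rightarrow> 'b graph" where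
  "relabel f G = Graph (f ` verts G) ((`) f ` edges G)"

text \<open>
  To have one type for all numbers of factors, the iterated product
  \<open>G\<^sub>1 \<box> (G\<^sub>2 \<box> (\<dots> \<box> G\<^sub>d))\<close> is relabelled along the injection
  \<open>(u, xs) \<mapsto> u # xs\<close>, so its vertices are lists of length \<open>d\<close>. The empty product is the
  one-vertex graph; hence the product of a single factor \<open>G\<close> is \<open>G\<close> with each vertex \<open>u\<close>
  renamed to \<open>[u]\<close>.
\<close>

fun cart_prod_list :: "'a graph list \<Rightarrow> 'a list graph" where
  "cart_prod_list [] = Graph {[]} {}"
| "cart_prod_list (G # Gs) = relabel (\<lambda>(u, xs). u # xs) (cart_prod G (cart_prod_list Gs))"

definition discrete_torus :: "nat list \<Rightarrow> nat list graph" where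
  "discrete_torus ms = cart_prod_list (map cycle_graph ms)"

text \<open>\<open>even_torus d n\<close> has factors of lengths \<open>2 * n 1, \<dots>, 2 * n d\<close>; other values of \<open>n\<close>
  are irrelevant.\<close>

definition even_torus :: "nat \<Rightarrow> (nat \<Rightarrow> nat) \<Rightarrow> nat list graph" where
  "even_torus d n = discrete_torus (map (\<lambda>i. 2 * n i) [1..<d + 1])"

definition exceptional :: "nat \<Rightarrow> (nat \<Rightarrow> nat) \<Rightarrow> bool" where
  "exceptional d n \<longleftrightarrow> n 1 = 2 \<and> (\<forall>i\<in>{2..d}. [2 * n i = 2] (mod 4))"

lemma simple_graph_finite_edges:
  assumes "simple_graph G"
  shows "finite (edges G)"
proof (rule finite_subset)
  show "edges G \<subseteq> Pow (verts G)" using assms by (auto simp: simple_graph_def)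
  show "finite (Pow (verts G))" using assms by (simp add: simple_graph_def)
qed

lemma q_B_attained:
  fixes G :: "'a graph"
  assumes "simple_graph G"
  shows "\<exists>c :: 'a set \<Rightarrow> nat. B_coloring G c \<and> card (c ` edges G) = q_B G"
proof -
  obtain c :: "'a set \<Rightarrow> nat" where c: "inj_on c (edges G)"
    using finite_imp_inj_to_nat_seg[OF simple_graph_finite_edges[OF assms]] by blast
  then have "proper_edge_coloring G c"
    by (auto simp: proper_edge_coloring_def dest: inj_onD)
  moreover have "rainbow c F" if "is_four_cycle G F" for F
  proof -
    from that have "F \<subseteq> edges G" unfolding is_four_cycle_def by (elim exE conjE)
    with c show ?thesis unfolding rainbow_def by (rule inj_on_subset)
  qed
  ultimately have "\<exists>k. \<exists>c :: 'a set \<Rightarrow> nat. B_coloring G c \<and> card (c ` edges G) = k"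
    by (auto simp: B_coloring_def)
  then show ?thesis unfolding q_B_def by (rule LeastI_ex)
qed

lemma simple_graph_cycle:
  assumes "n \<ge> 2"
  shows "simple_graph (cycle_graph n)"
proof -
  have "i \<noteq> Suc i mod n" if "i < n" for i
    using that assms by (cases "Suc i = n") auto
  with assms show ?thesis by (auto simp: simple_graph_def cycle_graph_def card_insert_if)
qed

lemma simple_graph_no_loop:
  assumes "simple_graph G" "{u, v} \<in> edges G"
  shows "u \<noteq> v"
proof
  assume "u = v"
  then have "card {u} = 2" using assms by (simp add: simple_graph_def)
  then show False by simp
qed

lemma simple_graph_cart_prod:
  assumes G: "simple_graph G" and H: "simple_graph H"
  shows "simple_graph (cart_prod G H)"
proof -
  have "e \<subseteq> verts G \<times> verts H \<and> card e = 2" if e: "e \<in> edges (cart_prod G H)" for e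
  proof -
    from e obtain u x v y where e_eq: "e = {(u, x), (v, y)}"
      and mem: "u \<in> verts G" "v \<in> verts G" "x \<in> verts H" "y \<in> verts H"
      and adj: "{u, v} \<in> edges G \<and> x = y \<or> u = v \<and> {x, y} \<in> edges H"
      by (auto simp only: cart_prod_def graph.sel mem_Collect_eq)
    have "(u, x) \<noteq> (v, y)"
      using adj simple_graph_no_loop[OF G, of u v] simple_graph_no_loop[OF H, of x y] by auto
    with e_eq mem show ?thesis by simp
  qed
  then show ?thesis
    using G H by (simp add: simple_graph_def cart_prod_def)
qed

lemma simple_graph_relabel:
  assumes "simple_graph G" "inj f"
  shows "simple_graph (relabel f G)"
  using assms by (auto simp: simple_graph_def relabel_def card_image inj_on_subset)

lemma simple_graph_cart_prod_list:
  assumes "\<forall>G\<in>set Gs. simple_graph G"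
  shows "simple_graph (cart_prod_list Gs)"
  using assms
proof (induction Gs)
  case Nil
  then show ?case by (simp add: simple_graph_def)
next
  case (Cons G Gs)
  have "inj (\<lambda>(u, xs). u # xs)" by (auto simp: inj_def)
  with Cons show ?case by (auto intro!: simple_graph_relabel simple_graph_cart_prod)
qed

lemma simple_graph_discrete_torus:
  assumes "\<forall>m\<in>set ms. m \<ge> 2"
  shows "simple_graph (discrete_torus ms)"
  unfolding discrete_torus_def
  using assms by (auto intro!: simple_graph_cart_prod_list simple_graph_cycle)

end

theory Submission
  imports Defs
begin

text \<open>
  An edge of the torus is a vertex together with the direction in which it goes up, so an
  edge-coloring is a function \<open>f\<close> of a vertex and a direction. Its only 4-cycles are the
  axis-parallel squares and the factors \<open>C\<^sub>4\<close>, so \<open>f\<close> gives a B-coloring as soon as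
  the colors at each vertex differ, translating an edge by one step in another direction changes its
  color, and opposite edges of a factor \<open>C\<^sub>4\<close> have different colors.

  For the upper bounds it suffices to let the color depend on the position in \<open>C\<^sub>4\<close> and on
  the parities of the remaining coordinates; this leaves a finite search with a solution
  using 5 colors for \<open>d = 2\<close> and 6 colors for \<open>d = 3\<close>. Each further even cycle costs two
  new colors, alternating along it, and its parity shifts the six old colors by one.

  For \<open>d \<ge> 3\<close> the degree \<open>2 * d\<close> is a lower bound. For \<open>d = 2\<close> and four colors, every
  vertex and every copy of \<open>C\<^sub>4\<close> sees all colors. This forces the coloring of each copy of
  \<open>C\<^sub>4\<close> to be the previous one rotated by a quarter turn, always in the same direction, which is
  impossible around a cycle of length 2 modulo 4.
\<close>

section \<open>Edges of a discrete torus\<close>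

text \<open>Orienting edges upwards makes the pair \<open>(xs, i)\<close> a unique name of an edge
  once all lengths are at least 3.\<close>

definition step :: "nat list \<Rightarrow> nat \<Rightarrow> nat list \<Rightarrow> nat list" where
  "step ms i xs = xs[i := (xs ! i + 1) mod ms ! i]"

lemma length_step [simp]: "length (step ms i xs) = length xs"
  by (simp add: step_def)

lemma nth_step:
  "i < length xs \<Longrightarrow> step ms i xs ! k = (if k = i then (xs ! i + 1) mod ms ! i else xs ! k)"
  by (simp add: step_def)

lemma step_in_torus:
  assumes "list_all2 (<) xs ms" "i < length ms"
  shows "list_all2 (<) (step ms i xs) ms"
  using assms by (fastforce simp: list_all2_conv_all_nth nth_step)

lemma verts_torus: "verts (discrete_torus ms) = {xs. list_all2 (<) xs ms}"
  unfolding discrete_torus_def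
  by (induction ms)
    (auto simp: relabel_def cart_prod_def cycle_graph_def list_all2_Cons2 image_iff)

text \<open>An edge runs either along the new first factor or inside a copy of the smaller torus.
  Simplicity of the latter lets its edges be written as pairs of its vertices.\<close>

lemma edges_torus_Cons:
  "edges (discrete_torus (m # ms)) =
     {{p # xs, (p + 1) mod m # xs} | p xs. p < m \<and> list_all2 (<) xs ms} \<union>
     {(#) p ` e | p e. p < m \<and> e \<in> edges (discrete_torus ms)}" (is "?L = ?A \<union> ?B")
  if simple: "simple_graph (discrete_torus ms)"
proof (rule set_eqI)
  let ?T = "discrete_torus ms"
  let ?f = "\<lambda>(u :: nat, xs). u # xs"
  fix e
  have "e \<in> ?L \<longleftrightarrow> (\<exists>u x v y. e = {u # x, v # y} \<and> u < m \<and> v < m \<and> x \<in> verts ?T \<and> y \<in> verts ?T \<and>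
     ((\<exists>i. {u, v} = {i, (i + 1) mod m} \<and> i < m) \<and> x = y \<or> u = v \<and> {x, y} \<in> edges ?T))"
  proof -
    have "e \<in> ?L \<longleftrightarrow> (\<exists>u x v y. e = ?f ` {(u, x), (v, y)} \<and> u < m \<and> v < m \<and> x \<in> verts ?T \<and> y \<in> verts ?T \<and>
       ({u, v} \<in> edges (cycle_graph m) \<and> x = y \<or> u = v \<and> {x, y} \<in> edges ?T))"
      unfolding discrete_torus_def list.map cart_prod_list.simps relabel_def cart_prod_def graph.sel
        image_iff Bex_def mem_Collect_eq
      by (simp only: cycle_graph_def graph.sel atLeastLessThan_iff) blast
    then show ?thesis
      by (simp only: cycle_graph_def graph.sel mem_Collect_eq image_insert image_empty case_prod_conv)
  qed
  also have "\<dots> \<longleftrightarrow> e \<in> ?A \<union> ?B"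
  proof
    assume "\<exists>u x v y. e = {u # x, v # y} \<and> u < m \<and> v < m \<and> x \<in> verts ?T \<and> y \<in> verts ?T \<and>
     ((\<exists>i. {u, v} = {i, (i + 1) mod m} \<and> i < m) \<and> x = y \<or> u = v \<and> {x, y} \<in> edges ?T)"
    then obtain u x v y where e: "e = {u # x, v # y}" "u < m" "v < m" "x \<in> verts ?T" "y \<in> verts ?T"
      and "(\<exists>i. {u, v} = {i, (i + 1) mod m} \<and> i < m) \<and> x = y \<or> u = v \<and> {x, y} \<in> edges ?T" by blast
    then consider p where "p < m" "{u, v} = {p, (p + 1) mod m}" "x = y" | "u = v" "{x, y} \<in> edges ?T"
      by blast
    then show "e \<in> ?A \<union> ?B"
    proof cases
      case 1
      then have "e = {p # x, (p + 1) mod m # x}" using e by (auto simp: doubleton_eq_iff)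
      then show ?thesis using 1 e by (auto simp: verts_torus)
    next
      case 2
      then have "e = (#) u ` {x, y}" using e by auto
      then show ?thesis using 2 e by blast
    qed
  next
    assume "e \<in> ?A \<union> ?B"
    then consider p xs where "e = {p # xs, (p + 1) mod m # xs}" "p < m" "list_all2 (<) xs ms"
      | p e' where "e = (#) p ` e'" "p < m" "e' \<in> edges ?T" by blast
    then show "\<exists>u x v y. e = {u # x, v # y} \<and> u < m \<and> v < m \<and> x \<in> verts ?T \<and> y \<in> verts ?T \<and>
     ((\<exists>i. {u, v} = {i, (i + 1) mod m} \<and> i < m) \<and> x = y \<or> u = v \<and> {x, y} \<in> edges ?T)"
    proof cases
      case 1
      moreover have "(p + 1) mod m < m" using 1 by simp
      ultimately show ?thesis unfolding verts_torus by blast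
    next
      case 2
      then obtain x y where "e' = {x, y}" "x \<in> verts ?T" "y \<in> verts ?T"
        using simple by (auto simp: simple_graph_def card_2_iff)
      then show ?thesis using 2 by blast
    qed
  qed
  finally show "e \<in> ?L \<longleftrightarrow> e \<in> ?A \<union> ?B" .
qed

lemma edges_torus:
  assumes "\<forall>m\<in>set ms. 2 \<le> m"
  shows "edges (discrete_torus ms) =
    {{xs, step ms i xs} | xs i. list_all2 (<) xs ms \<and> i < length ms}"
  using assms
proof (induction ms)
  case Nil
  then show ?case by (simp add: discrete_torus_def)
next
  case (Cons m ms)
  have IH: "edges (discrete_torus ms) =
    {{xs, step ms i xs} | xs i. list_all2 (<) xs ms \<and> i < length ms}"
    using Cons by simp
  have s: "step (m # ms) 0 (p # xs) = (p + 1) mod m # xs"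
    "step (m # ms) (Suc i) (p # xs) = p # step ms i xs" for p i xs
    by (simp_all add: step_def)
  have "e \<in> edges (discrete_torus (m # ms)) \<longleftrightarrow>
    e \<in> {{xs, step (m # ms) i xs} | xs i. list_all2 (<) xs (m # ms) \<and> i < length (m # ms)}"
    (is "_ \<longleftrightarrow> e \<in> ?R") for e
  proof -
    have "e \<in> edges (discrete_torus (m # ms)) \<longleftrightarrow>
      (\<exists>p xs. p < m \<and> list_all2 (<) xs ms \<and> e = {p # xs, step (m # ms) 0 (p # xs)}) \<or>
      (\<exists>p xs i. p < m \<and> list_all2 (<) xs ms \<and> i < length ms \<and> e = {p # xs, step (m # ms) (Suc i) (p # xs)})"
    proof -
      have "(\<exists>p e'. e = (#) p ` e' \<and> p < m \<and> e' \<in> edges (discrete_torus ms)) \<longleftrightarrow>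
        (\<exists>p xs i. p < m \<and> list_all2 (<) xs ms \<and> i < length ms \<and> e = {p # xs, p # step ms i xs})"
      proof
        assume "\<exists>p e'. e = (#) p ` e' \<and> p < m \<and> e' \<in> edges (discrete_torus ms)"
        then show "\<exists>p xs i. p < m \<and> list_all2 (<) xs ms \<and> i < length ms \<and> e = {p # xs, p # step ms i xs}"
          unfolding IH by auto
      next
        assume "\<exists>p xs i. p < m \<and> list_all2 (<) xs ms \<and> i < length ms \<and> e = {p # xs, p # step ms i xs}"
        then obtain p xs i where "p < m" "list_all2 (<) xs ms" "i < length ms" "e = (#) p ` {xs, step ms i xs}"
          by auto
        then show "\<exists>p e'. e = (#) p ` e' \<and> p < m \<and> e' \<in> edges (discrete_torus ms)"
          unfolding IH by blast
      qed
      moreover have "simple_graph (discrete_torus ms)"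
        using Cons.prems by (intro simple_graph_discrete_torus) simp
      ultimately show ?thesis
        unfolding s by (subst edges_torus_Cons) (simp_all only: Un_iff mem_Collect_eq, blast)
    qed
    also have "\<dots> \<longleftrightarrow> (\<exists>p xs i. p < m \<and> list_all2 (<) xs ms \<and> i < Suc (length ms) \<and> e = {p # xs, step (m # ms) i (p # xs)})"
      by (metis Suc_less_eq not0_implies_Suc zero_less_Suc)
    also have "\<dots> \<longleftrightarrow> e \<in> ?R"
      by (simp add: list_all2_Cons2) blast
    finally show ?thesis .
  qed
  then show ?case by blast
qed

text \<open>With \<open>m \<ge> 3\<close> the successor modulo \<open>m\<close> cannot return after
  one or two steps. A return after four steps makes \<open>m\<close> divide 4, which leaves only 4
  among the lengths from 3 on.\<close>

lemma cyclic_succ_facts: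
  fixes p m :: nat
  assumes "3 \<le> m" "p < m"
  shows "(p + 1) mod m \<noteq> p"
    "((p + 1) mod m + 1) mod m \<noteq> p"
    "q < m \<Longrightarrow> (p + 1) mod m = (q + 1) mod m \<longleftrightarrow> p = q"
    "((((p + 1) mod m + 1) mod m + 1) mod m + 1) mod m = p \<Longrightarrow> m = 4"
proof -
  have *: "(x + 1) mod m = (if x + 1 = m then 0 else x + 1)" if "x < m" for x
    using that by auto
  have lt: "(p + 1) mod m < m" using assms by simp
  show "(p + 1) mod m \<noteq> p" "((p + 1) mod m + 1) mod m \<noteq> p"
    unfolding *[OF lt] using *[OF assms(2)] assms by (auto split: if_splits)
  show "(p + 1) mod m = (q + 1) mod m \<longleftrightarrow> p = q" if "q < m"
    unfolding *[OF that] *[OF assms(2)] using assms that by auto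
  assume "((((p + 1) mod m + 1) mod m + 1) mod m + 1) mod m = p"
  then have "(p + 4) mod m = p mod m" using assms by (simp add: mod_simps eval_nat_numeral)
  then have "m dvd 4" using mod_eq_dvd_iff_nat[of p "p + 4" m] by simp
  then show "m = 4" using assms dvd_imp_le[of m 4] by (cases "m = 3") auto
qed

section \<open>B-colorings and 4-cycles of a torus\<close>

text \<open>The description is definite on edges because an edge determines its tail and direction
  when all lengths are at least 3 (\<open>edge_unique\<close>); values on other sets are
  irrelevant.\<close>

definition torus_coloring :: "nat list \<Rightarrow> (nat list \<Rightarrow> nat \<Rightarrow> nat) \<Rightarrow> nat list set \<Rightarrow> nat" where
  "torus_coloring ms f e =
     (THE k. \<exists>xs i. list_all2 (<) xs ms \<and> i < length ms \<and> e = {xs, step ms i xs} \<and> k = f xs i)"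

text \<open>The classification of opposite edges yields an unordered pair of edges; this carries a
  color inequality over to the original pair.\<close>

lemma doubleton_image_ne:
  assumes "{p, q} = {a, b}" "g a \<noteq> g b"
  shows "g p \<noteq> g q"
  using assms by (auto simp: doubleton_eq_iff)

section \<open>Steps along the factors and unique names of edges\<close>

context
  fixes ms :: "nat list"
  assumes ms3: "\<forall>m\<in>set ms. 3 \<le> m"
begin

abbreviation (input) "V xs \<equiv> list_all2 (<) xs ms"
abbreviation (input) "S \<equiv> step ms"

lemma vertD: "V xs \<Longrightarrow> length xs = length ms" "V xs \<Longrightarrow> i < length ms \<Longrightarrow> xs ! i < ms ! i"
  by (auto simp: list_all2_conv_all_nth)

lemma ms_nth: "i < length ms \<Longrightarrow> 3 \<le> ms ! i"
  using ms3 by simp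

lemma step_nth_self:
  assumes "V xs" "i < length ms"
  shows "S i xs ! i \<noteq> xs ! i"
  using assms cyclic_succ_facts(1)[OF ms_nth vertD(2)] by (simp add: nth_step vertD)

lemma step_ne:
  assumes "V xs" "i < length ms"
  shows "S i xs \<noteq> xs"
  using step_nth_self[OF assms] by metis

text \<open>Forward steps in two directions leave coordinate \<open>i\<close> changed; in a single
  direction the length, at least 3, prevents a return.\<close>

lemma step_step_ne:
  assumes "V xs" "i < length ms" "j < length ms"
  shows "S j (S i xs) \<noteq> xs"
proof (cases "i = j")
  case True
  then have "S j (S i xs) ! i \<noteq> xs ! i"
    using assms cyclic_succ_facts(2)[OF ms_nth vertD(2)] by (simp add: nth_step vertD)
  then show ?thesis by metis
next
  case False
  then have "S j (S i xs) ! i \<noteq> xs ! i"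
    using assms step_nth_self by (simp add: nth_step vertD)
  then show ?thesis by metis
qed

lemma step_inj_dir:
  assumes "V xs" "i < length ms" "j < length ms" "S i xs = S j xs"
  shows "i = j"
proof (rule ccontr)
  assume "i \<noteq> j"
  then have "S j xs ! i = xs ! i" using assms by (simp add: nth_step vertD)
  then show False using assms step_nth_self by metis
qed

lemma step_inj:
  assumes "V xs" "V ys" "i < length ms" "S i xs = S i ys"
  shows "xs = ys"
proof (rule nth_equalityI)
  show "length xs = length ys" using assms vertD by metis
  fix k assume k: "k < length xs"
  have "(if p = i then (xs ! i + 1) mod ms ! i else xs ! p) =
    (if p = i then (ys ! i + 1) mod ms ! i else ys ! p)" for p
    using arg_cong[OF assms(4), of "\<lambda>a. a ! p"] assms(1-3) by (simp only: nth_step vertD)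
  from this[of i] this[of k] show "xs ! k = ys ! k"
    using cyclic_succ_facts(3)[OF ms_nth vertD(2)[OF assms(1)] vertD(2)[OF assms(2)]] assms(3)
    by (auto split: if_splits)
qed

lemma step_eqI:
  assumes "V xs" "V ys" "i < length ms" "ys ! i = (xs ! i + 1) mod ms ! i"
    and "\<And>k. k < length ms \<Longrightarrow> k \<noteq> i \<Longrightarrow> ys ! k = xs ! k"
  shows "ys = S i xs"
  using assms by (intro nth_equalityI) (auto simp: nth_step vertD)

text \<open>If the tails differed, each would be a step from the other, and two forward steps would
  close up. With equal tails the step determines its direction.\<close>

lemma edge_unique:
  assumes "V xs" "V ys" "i < length ms" "j < length ms" "{xs, S i xs} = {ys, S j ys}"
  shows "xs = ys \<and> i = j"
  using assms step_inj_dir step_step_ne by (metis doubleton_eq_iff)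

lemma torus_coloring_edge:
  assumes "V xs" "i < length ms"
  shows "torus_coloring ms f {xs, S i xs} = f xs i"
  unfolding torus_coloring_def
  using assms edge_unique by (intro the_equality) blast+

text \<open>Two edges in different directions with a common upper end are the far sides of a square.
  Its lower corner is \<open>x\<close> with coordinate \<open>j\<close> moved back, and that earlier
  value is \<open>y ! j\<close> because the two steps meet.\<close>

lemma step_meet:
  assumes "V x" "V y" "i < length ms" "j < length ms" "i \<noteq> j" "S i x = S j y"
  obtains z where "V z" "x = S j z" "y = S i z"
proof
  let ?z = "x[j := y ! j]"
  have len: "length x = length ms" "length y = length ms" using assms vertD by auto
  have nth: "(if k = i then (x ! i + 1) mod ms ! i else x ! k) =
    (if k = j then (y ! j + 1) mod ms ! j else y ! k)" for k
    using arg_cong[OF assms(6), of "\<lambda>a. a ! k"] assms(1-4) by (simp only: nth_step vertD)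
  show "V ?z" using assms by (auto simp: list_all2_conv_all_nth nth_list_update)
  show "x = S j ?z"
  proof (rule nth_equalityI)
    fix k assume "k < length x"
    then show "x ! k = S j ?z ! k" using nth[of k] assms len by (auto simp: nth_step split: if_splits)
  qed simp
  show "y = S i ?z"
  proof (rule nth_equalityI)
    fix k assume "k < length y"
    then show "y ! k = S i ?z ! k" using nth[of k] assms len
      by (auto simp: nth_step nth_list_update split: if_splits)
  qed (simp add: len)
qed

section \<open>Adjacency and the 4-cycles of the torus\<close>

lemma edges_torus_iff: "e \<in> edges (discrete_torus ms) \<longleftrightarrow> (\<exists>xs i. V xs \<and> i < length ms \<and> e = {xs, S i xs})"
proof -
  have "\<forall>m\<in>set ms. 2 \<le> m" using ms3 by auto
  then show ?thesis using edges_torus by blast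
qed

lemma edge_cases:
  assumes "{u, v} \<in> edges (discrete_torus ms)"
  obtains i where "V u" "V v" "i < length ms" "v = S i u \<or> u = S i v"
    "u ! i \<noteq> v ! i" "\<forall>k. k \<noteq> i \<longrightarrow> u ! k = v ! k"
proof -
  obtain xs i where *: "V xs" "i < length ms" "{u, v} = {xs, S i xs}"
    using assms edges_torus_iff by blast
  then have adj: "v = S i u \<or> u = S i v" by (auto simp: doubleton_eq_iff)
  have V: "V u" "V v" using * step_in_torus[of xs ms i] by (auto simp: doubleton_eq_iff)
  have "u ! i \<noteq> v ! i"
    using adj V *(2) step_nth_self by metis
  moreover have "\<forall>k. k \<noteq> i \<longrightarrow> u ! k = v ! k"
    using adj V *(2) by (auto simp: nth_step vertD)
  ultimately show ?thesis using adj V *(2) that by blast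
qed

text \<open>A closed walk must undo every change of a coordinate. Hence a 4-cycle that turns at its
  second vertex is a square, and one that does not turn there runs once around a factor of length 4.
  Only one pair of opposite edges is described; the other follows by rotating the cycle.\<close>

lemma four_cycle_opposite:
  assumes "distinct [u, v, w, x]"
    and "{u, v} \<in> edges (discrete_torus ms)" "{v, w} \<in> edges (discrete_torus ms)"
    and "{w, x} \<in> edges (discrete_torus ms)" "{x, u} \<in> edges (discrete_torus ms)"
  obtains (translate) a i j where "V a" "i < length ms" "j < length ms" "i \<noteq> j"
      "{{u, v}, {w, x}} = {{a, S i a}, {S j a, S i (S j a)}}"
  | (wrap) a i where "V a" "i < length ms" "ms ! i = 4"
      "{{u, v}, {w, x}} = {{a, S i a}, {S i (S i a), S i (S i (S i a))}}"
proof -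
  obtain i where uv: "V u" "V v" "i < length ms" "v = S i u \<or> u = S i v" "u ! i \<noteq> v ! i"
    "\<forall>p. p \<noteq> i \<longrightarrow> u ! p = v ! p" by (rule edge_cases[OF assms(2)], rule that) assumption+
  obtain j where vw: "V w" "j < length ms" "w = S j v \<or> v = S j w" "v ! j \<noteq> w ! j"
    "\<forall>p. p \<noteq> j \<longrightarrow> v ! p = w ! p" by (rule edge_cases[OF assms(3)], rule that) assumption+
  obtain k where wx: "V x" "w ! k \<noteq> x ! k" "k < length ms" "x = S k w \<or> w = S k x"
    "\<forall>p. p \<noteq> k \<longrightarrow> w ! p = x ! p" by (rule edge_cases[OF assms(4)], rule that) assumption+
  obtain l where xu: "x ! l \<noteq> u ! l" "l < length ms" "u = S l x \<or> x = S l u"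
    "\<forall>p. p \<noteq> l \<longrightarrow> x ! p = u ! p" by (rule edge_cases[OF assms(5)], rule that) assumption+
  have eqI: "a = b" if "V a" "V b" "\<And>p. a ! p = b ! p" for a b
    using that vertD by (intro nth_equalityI) auto
  show thesis
  proof (cases "i = j")
    case False
    \<comment> \<open>\<open>u\<close> and \<open>w\<close> differ in both coordinates, so the last
      two edges restore one each.\<close>
    have "w ! i \<noteq> u ! i" "w ! j \<noteq> u ! j"
      using uv(5,6) vw(4,5) False by metis+
    then have "k = i \<and> l = j \<or> k = j \<and> l = i"
      using wx(5) xu(4) False by metis
    \<comment> \<open>Undoing \<open>j\<close> first would retrace the edge from \<open>v\<close> to
      \<open>w\<close>, making \<open>x = v\<close>.\<close>
    moreover have "\<not> (k = j \<and> l = i)"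
    proof
      assume "k = j \<and> l = i"
      then have "x ! p = v ! p" for p
        using uv(6) vw(5) wx(5) xu(4) False by metis
      then have "x = v" using wx(1) uv(2) eqI by blast
      then show False using assms(1) by simp
    qed
    ultimately have kl: "k = i" "l = j" by auto
    \<comment> \<open>The ends of opposite sides agree pairwise in the coordinate along which the
      sides run, so both sides point the same way.\<close>
    have lift: "v = S i u \<Longrightarrow> w = S i x" "u = S i v \<Longrightarrow> x = S i w"
      "w = S j v \<Longrightarrow> x = S j u" "v = S j w \<Longrightarrow> u = S j x"
    proof -
      have *: "w ! i = v ! i" "x ! i = u ! i" "v ! j = u ! j" "w ! j = x ! j"
        using uv(6) vw(5) wx(5) xu(4) kl False by metis+
      have nth: "S p a ! p = (a ! p + 1) mod ms ! p" if "V a" "p < length ms" for a p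
        using that by (simp add: nth_step vertD)
      show "w = S i x" if "v = S i u"
        using that * nth[OF uv(1,3)] wx(5) kl
        by (intro step_eqI[OF wx(1) vw(1) uv(3)]) metis+
      show "x = S i w" if "u = S i v"
        using that * nth[OF uv(2,3)] wx(5) kl
        by (intro step_eqI[OF vw(1) wx(1) uv(3)]) metis+
      show "x = S j u" if "w = S j v"
        using that * nth[OF uv(2) vw(2)] xu(4) kl
        by (intro step_eqI[OF uv(1) wx(1) vw(2)]) metis+
      show "u = S j x" if "v = S j w"
        using that * nth[OF vw(1,2)] xu(4) kl
        by (intro step_eqI[OF wx(1) uv(1) vw(2)]) metis+
    qed
    show thesis
    \<comment> \<open>The base of the square is the corner that both its sides leave forwards; the
      two orientations decide which corner that is.\<close>
    proof (cases "v = S i u"; cases "w = S j v")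
      assume *: "v = S i u" "w = S j v"
      have eq: "w = S i x" "x = S j u" using lift * by blast+
      have "{{u, v}, {w, x}} = {{u, S i u}, {S j u, S i (S j u)}}"
        unfolding eq *(1) by blast
      then show thesis by (rule translate[OF uv(1,3) vw(2) False])
    next
      assume *: "v = S i u" "w \<noteq> S j v"
      then have eq: "w = S i x" "u = S j x" using lift vw(3) by blast+
      have "{{u, v}, {w, x}} = {{x, S i x}, {S j x, S i (S j x)}}"
        unfolding *(1) eq by blast
      then show thesis by (rule translate[OF wx(1) uv(3) vw(2) False])
    next
      assume *: "v \<noteq> S i u" "w = S j v"
      then have eq: "u = S i v" "x = S i w" using lift uv(4) by blast+
      have "{{u, v}, {w, x}} = {{v, S i v}, {S j v, S i (S j v)}}"
        unfolding eq *(2) by blast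
      then show thesis by (rule translate[OF uv(2,3) vw(2) False])
    next
      assume "v \<noteq> S i u" "w \<noteq> S j v"
      then have eq: "u = S i v" "x = S i w" "v = S j w" using lift uv(4) vw(3) by blast+
      have "{{u, v}, {w, x}} = {{w, S i w}, {S j w, S i (S j w)}}"
        unfolding eq by blast
      then show thesis by (rule translate[OF vw(1) uv(3) vw(2) False])
    qed
  next
    case True
    have "w \<noteq> u" "x \<noteq> u" "w \<noteq> x" "x \<noteq> v" using assms(1) by auto
    have "w ! i \<noteq> u ! i"
      using eqI[OF vw(1) uv(1)] \<open>w \<noteq> u\<close> uv(6) vw(5) True by metis
    \<comment> \<open>A third edge in another direction would leave two coordinates for the last
      edge to restore.\<close>
    then have "k = i" using True uv(6) vw(5) wx(2,5) xu(4) by metis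
    then have "l = i" using True uv(6) vw(5) wx(5) xu(1) by metis
    note inj = step_inj[OF _ _ uv(3)]
    show thesis
    proof (cases "v = S i u")
      case v: True
      \<comment> \<open>A change of orientation would, by injectivity of the step, lead back to the
        vertex just left; so all four edges point the same way.\<close>
      then have w: "w = S i v" using vw(1,3) uv(1) \<open>w \<noteq> u\<close> inj True by blast
      then have x: "x = S i w" using wx(1,4) uv(2) \<open>x \<noteq> v\<close> inj \<open>k = i\<close> by blast
      then have u: "u = S i x" using xu(3) uv(1) vw(1) \<open>w \<noteq> u\<close> inj \<open>l = i\<close> by blast
      have "((((u ! i + 1) mod ms ! i + 1) mod ms ! i + 1) mod ms ! i + 1) mod ms ! i = u ! i"
        using arg_cong[OF u, of "\<lambda>a. a ! i"] unfolding x w v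
        using uv(1,3) by (simp add: nth_step vertD)
      then have "ms ! i = 4" using uv(1,3) by (intro cyclic_succ_facts(4)[OF ms_nth vertD(2)])
      moreover have "{{u, v}, {w, x}} = {{u, S i u}, {S i (S i u), S i (S i (S i u))}}"
        unfolding x w v by blast
      ultimately show thesis by (rule wrap[OF uv(1,3)])
    next
      case False
      then have v: "u = S i v" using uv(4) by blast
      then have w: "v = S i w" using vw(3) \<open>w \<noteq> u\<close> True by blast
      then have x: "w = S i x" using wx(4) \<open>x \<noteq> v\<close> \<open>k = i\<close> by blast
      then have u: "x = S i u" using xu(3) \<open>w \<noteq> u\<close> \<open>l = i\<close> by blast
      have "((((x ! i + 1) mod ms ! i + 1) mod ms ! i + 1) mod ms ! i + 1) mod ms ! i = x ! i"
        using arg_cong[OF u, of "\<lambda>a. a ! i"] unfolding v w x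
        using wx(1) uv(3) by (simp add: nth_step vertD)
      then have "ms ! i = 4" using wx(1) uv(3) by (intro cyclic_succ_facts(4)[OF ms_nth vertD(2)])
      moreover have "{{u, v}, {w, x}} = {{x, S i x}, {S i (S i x), S i (S i (S i x))}}"
        unfolding v w x by blast
      ultimately show thesis by (rule wrap[OF wx(1) uv(3)])
    qed
  qed
qed

text \<open>Two distinct edges can meet in three ways: at a common tail (\<open>P1\<close>), head to
  tail (\<open>P2\<close>), or at a common head (\<open>P3\<close>), where \<open>step_meet\<close>
  supplies the square. \<open>Q\<close> and \<open>R\<close> separate opposite edges in the two
  outcomes of \<open>four_cycle_opposite\<close>.\<close>

lemma B_coloring_torus_coloring:
  assumes P1: "\<And>x i j. V x \<Longrightarrow> i < length ms \<Longrightarrow> j < length ms \<Longrightarrow> i \<noteq> j \<Longrightarrow> f x i \<noteq> f x j"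
    and P2: "\<And>x i j. V x \<Longrightarrow> i < length ms \<Longrightarrow> j < length ms \<Longrightarrow> f x i \<noteq> f (S i x) j"
    and P3: "\<And>x i j. V x \<Longrightarrow> i < length ms \<Longrightarrow> j < length ms \<Longrightarrow> i \<noteq> j \<Longrightarrow> f (S j x) i \<noteq> f (S i x) j"
    and Q: "\<And>x i j. V x \<Longrightarrow> i < length ms \<Longrightarrow> j < length ms \<Longrightarrow> i \<noteq> j \<Longrightarrow> f x i \<noteq> f (S j x) i"
    and R: "\<And>x i. V x \<Longrightarrow> i < length ms \<Longrightarrow> ms ! i = 4 \<Longrightarrow> f x i \<noteq> f (S i (S i x)) i"
  shows "B_coloring (discrete_torus ms) (torus_coloring ms f)"
proof -
  let ?T = "discrete_torus ms" and ?c = "torus_coloring ms f"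
  note col = torus_coloring_edge[of _ _ f]
  have proper: "?c e \<noteq> ?c e'" if "e \<in> edges ?T" "e' \<in> edges ?T" "e \<noteq> e'" "e \<inter> e' \<noteq> {}" for e e'
  proof -
    obtain x i where e: "V x" "i < length ms" "e = {x, S i x}" using \<open>e \<in> _\<close> edges_torus_iff by blast
    obtain y j where e': "V y" "j < length ms" "e' = {y, S j y}" using \<open>e' \<in> _\<close> edges_torus_iff by blast
    have c: "?c e = f x i" "?c e' = f y j" using col e e' by simp_all
    from that(4) e(3) e'(3) consider "x = y" | "S i x = y" | "x = S j y" | "S i x = S j y" by blast
    then show ?thesis
    proof cases
      case 1
      then have "i \<noteq> j" using that(3) e(3) e'(3) by blast
      then show ?thesis using 1 P1[OF e(1,2) e'(2)] c by simp
    next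
      case 2
      then show ?thesis using P2[OF e(1,2) e'(2)] c by simp
    next
      case 3
      then show ?thesis using P2[OF e'(1,2) e(2)] c by simp
    next
      case 4
      then have "i \<noteq> j" using that(3) e e' step_inj by blast
      then obtain z where "V z" "x = S j z" "y = S i z"
        using 4 step_meet[OF e(1) e'(1) e(2) e'(2)] by blast
      then show ?thesis using \<open>i \<noteq> j\<close> P3[of z i j] e(2) e'(2) c by simp
    qed
  qed
  have opp: "?c {u, v} \<noteq> ?c {w, x}" if "distinct [u, v, w, x]"
    "{u, v} \<in> edges ?T" "{v, w} \<in> edges ?T" "{w, x} \<in> edges ?T" "{x, u} \<in> edges ?T" for u v w x
    using that
  proof (cases rule: four_cycle_opposite)
    case (translate a i j)
    then have "?c {a, S i a} \<noteq> ?c {S j a, S i (S j a)}"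
      using Q[of a i j] col[of a i] col[of "S j a" i] step_in_torus[of a ms j] by simp
    then show ?thesis by (rule doubleton_image_ne[OF translate(5)])
  next
    case (wrap a i)
    then have "?c {a, S i a} \<noteq> ?c {S i (S i a), S i (S i (S i a))}"
      using R[of a i] col[of a i] col[of "S i (S i a)" i] step_in_torus[of a ms i] step_in_torus[of "S i a" ms i] by simp
    then show ?thesis by (rule doubleton_image_ne[OF wrap(4)])
  qed
  have "rainbow ?c F" if F: "is_four_cycle ?T F" for F
  proof -
    from F obtain u v w x where d: "distinct [u, v, w, x]" and F: "F = {{u, v}, {v, w}, {w, x}, {x, u}}"
      and sub: "F \<subseteq> edges ?T" by (auto simp: is_four_cycle_def)
    have E: "{u, v} \<in> edges ?T" "{v, w} \<in> edges ?T" "{w, x} \<in> edges ?T" "{x, u} \<in> edges ?T"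
      using sub F by auto
    have ne: "{u, v} \<noteq> {v, w}" "{v, w} \<noteq> {w, x}" "{w, x} \<noteq> {x, u}" "{x, u} \<noteq> {u, v}"
      using d by (auto simp: doubleton_eq_iff)
    have "?c {u, v} \<noteq> ?c {w, x}" "?c {v, w} \<noteq> ?c {x, u}"
      using opp[of u v w x] opp[of v w x u] d E by auto
    moreover have "?c {u, v} \<noteq> ?c {v, w}" "?c {v, w} \<noteq> ?c {w, x}" "?c {w, x} \<noteq> ?c {x, u}" "?c {x, u} \<noteq> ?c {u, v}"
      using proper[OF E(1,2) ne(1)] proper[OF E(2,3) ne(2)] proper[OF E(3,4) ne(3)] proper[OF E(4,1) ne(4)] by blast+
    ultimately show ?thesis unfolding rainbow_def F inj_on_insert by auto
  qed
  then show ?thesis using proper by (auto simp: B_coloring_def proper_edge_coloring_def)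
qed

end

section \<open>Upper bounds and the degree bound\<close>

lemma q_B_le:
  assumes "B_coloring G c" "c ` edges G \<subseteq> {..<k}"
  shows "q_B G \<le> k"
proof -
  have "q_B G \<le> card (c ` edges G)"
    unfolding q_B_def by (rule Least_le) (use assms(1) in blast)
  also have "\<dots> \<le> k" using card_mono[OF _ assms(2)] by simp
  finally show ?thesis .
qed

lemma q_B_torus_le:
  assumes ms3: "\<forall>m\<in>set ms. 3 \<le> m"
    and "B_coloring (discrete_torus ms) (torus_coloring ms f)"
    and "\<And>x i. list_all2 (<) x ms \<Longrightarrow> i < length ms \<Longrightarrow> f x i < k"
  shows "q_B (discrete_torus ms) \<le> k"
proof (rule q_B_le[OF assms(2)])
  show "torus_coloring ms f ` edges (discrete_torus ms) \<subseteq> {..<k}"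
    using assms(3) torus_coloring_edge[OF ms3] by (auto simp: edges_torus_iff[OF ms3])
qed

text \<open>The \<open>2 * length ms\<close> edges at one vertex need different colors.\<close>

lemma q_B_torus_ge:
  assumes ms3: "\<forall>m\<in>set ms. 3 \<le> m"
  shows "2 * length ms \<le> q_B (discrete_torus ms)"
proof -
  let ?T = "discrete_torus ms" and ?d = "length ms"
  have simple: "simple_graph ?T" using ms3 by (intro simple_graph_discrete_torus) auto
  obtain c :: "nat list set \<Rightarrow> nat" where c: "B_coloring ?T c" "card (c ` edges ?T) = q_B ?T"
    using q_B_attained[OF simple] by blast
  define z :: "nat list" where "z = replicate ?d 0"
  \<comment> \<open>\<open>y i\<close> is the neighbour preceding \<open>z\<close> in direction
    \<open>i\<close>, across the wrap-around.\<close>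
  define y where "y i = z[i := ms ! i - 1]" for i
  have m: "3 \<le> ms ! k" if "k < ?d" for k using ms3 that by simp
  have V: "list_all2 (<) z ms" using m by (force simp: list_all2_conv_all_nth z_def)
  have yV: "list_all2 (<) (y i) ms" and yz: "step ms i (y i) = z" if "i < ?d" for i
    using m[OF that] V that
    by (auto simp: list_all2_conv_all_nth nth_list_update y_def step_def z_def list_eq_iff_nth_eq)
  define g where "g = (\<lambda>(i, up). if up then {z, step ms i z} else {y i, step ms i (y i)})"
  have "inj_on g ({..<?d} \<times> UNIV)"
  proof -
    have "y i \<noteq> z" if "i < ?d" for i
      using step_ne[OF ms3 yV[OF that] that] yz[OF that] by simp
    then have "p = q" if "g p = g q" "fst p < ?d" "fst q < ?d" for p q
      using that edge_unique[OF ms3] V yV unfolding g_def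
      by (cases p; cases q) (auto simp only: fst_conv snd_conv case_prod_conv split: if_splits, metis+)
    then show ?thesis by (force intro!: inj_onI)
  qed
  moreover have g: "g p \<in> edges ?T" "z \<in> g p" if "fst p < ?d" for p
    using that V yV[of "fst p"] yz[of "fst p"] unfolding g_def edges_torus_iff[OF ms3]
    by (cases p; auto split: if_splits; metis)+
  ultimately have "inj_on (c \<circ> g) ({..<?d} \<times> UNIV)"
  proof (intro comp_inj_on)
    show "inj_on c (g ` ({..<?d} \<times> UNIV))"
    proof (rule inj_onI)
      fix e e' assume "e \<in> g ` ({..<?d} \<times> UNIV)" "e' \<in> g ` ({..<?d} \<times> UNIV)" "c e = c e'"
      moreover from this have "e \<in> edges ?T" "e' \<in> edges ?T" "z \<in> e \<inter> e'" using g by auto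
      ultimately show "e = e'"
        using c(1) unfolding B_coloring_def proper_edge_coloring_def by (metis empty_iff)
    qed
  qed
  then have "card ({..<?d} \<times> (UNIV :: bool set)) \<le> card (c ` edges ?T)"
    using g by (intro card_inj_on_le[of "c \<circ> g"]) (auto simp: simple_graph_finite_edges[OF simple])
  then show ?thesis using c by (simp add: card_cartesian_product)
qed

text \<open>Each step, even the one that wraps around to 0, flips the parity of its coordinate,
  since the length is even.\<close>

lemma parity_sum_step:
  assumes "\<forall>m\<in>set ms. even m" "list_all2 (<) xs ms" "i < length ms" "finite A"
  shows "even (\<Sum>j\<in>A. step ms i xs ! j) \<longleftrightarrow> (even (\<Sum>j\<in>A. xs ! j) \<longleftrightarrow> i \<notin> A)"
proof -
  have len: "length xs = length ms" using assms(2) by (simp add: list_all2_lengthD)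
  have "even (ms ! i)" using assms by simp
  then have "even ((xs ! i + 1) mod ms ! i) \<longleftrightarrow> odd (xs ! i)"
    by (simp add: dvd_mod_iff)
  moreover have "(\<Sum>j\<in>A - {i}. step ms i xs ! j) = (\<Sum>j\<in>A - {i}. xs ! j)"
    using assms len by (intro sum.cong) (auto simp: nth_step)
  ultimately show ?thesis
    using assms(3,4) len sum.remove[of A i "\<lambda>j. step ms i xs ! j"] sum.remove[of A i "\<lambda>j. xs ! j"]
    by (cases "i \<in> A") (auto simp: nth_step)
qed

section \<open>Colorings of finite quotients of the torus\<close>

text \<open>The entries of both tables were found by computer search.\<close>

definition color3 :: "nat \<Rightarrow> nat \<times> nat \<times> nat \<Rightarrow> nat" where
  "color3 i = (\<lambda>(a, b, c).
    [[0, 1, 3, 4, 1, 0, 4, 3, 4, 3, 1, 0, 3, 4, 0, 1],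
     [1, 0, 4, 3, 2, 5, 5, 2, 0, 4, 3, 1, 5, 2, 2, 5],
     [2, 5, 5, 2, 3, 4, 0, 1, 5, 2, 2, 5, 0, 1, 4, 3]] ! i ! (4 * a + 2 * b + c))"

definition shift3 :: "nat \<Rightarrow> nat \<times> nat \<times> nat \<Rightarrow> nat \<times> nat \<times> nat" where
  "shift3 i = (\<lambda>(a, b, c). if i = 0 then ((a + 1) mod 4, b, c)
     else if i = 1 then (a, (b + 1) mod 2, c) else (a, b, (c + 1) mod 2))"

text \<open>These are the hypotheses of \<open>B_coloring_torus_coloring\<close> on the 16 points of
  the quotient, with \<open>shift3\<close> as the image of \<open>step\<close>. The last condition
  concerns direction 0, the only one whose factor has length 4.\<close>

lemma color3_check:
  "\<forall>v \<in> {..<4} \<times> {..<2} \<times> {..<2}. \<forall>i<3. color3 i v < 6 \<and>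
     (\<forall>j<3. color3 i v \<noteq> color3 j (shift3 i v) \<and>
       (i \<noteq> j \<longrightarrow> color3 i v \<noteq> color3 j v \<and> color3 i (shift3 j v) \<noteq> color3 j (shift3 i v) \<and>
         color3 i v \<noteq> color3 i (shift3 j v))) \<and>
     color3 0 v \<noteq> color3 0 (shift3 0 (shift3 0 v))"
  by code_simp

definition color2 :: "nat \<Rightarrow> nat \<times> nat \<Rightarrow> nat" where
  "color2 i = (\<lambda>(a, b). [[0, 2, 1, 0, 4, 1, 2, 4], [1, 3, 3, 4, 2, 3, 3, 0]] ! i ! (2 * a + b))"

definition shift2 :: "nat \<Rightarrow> nat \<times> nat \<Rightarrow> nat \<times> nat" where
  "shift2 i = (\<lambda>(a, b). if i = 0 then ((a + 1) mod 4, b) else (a, (b + 1) mod 2))"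

lemma color2_check:
  "\<forall>v \<in> {..<4} \<times> {..<2}. \<forall>i<2. color2 i v < 5 \<and>
     (\<forall>j<2. color2 i v \<noteq> color2 j (shift2 i v) \<and>
       (i \<noteq> j \<longrightarrow> color2 i v \<noteq> color2 j v \<and> color2 i (shift2 j v) \<noteq> color2 j (shift2 i v) \<and>
         color2 i v \<noteq> color2 i (shift2 j v))) \<and>
     color2 0 v \<noteq> color2 0 (shift2 0 (shift2 0 v))"
  by code_simp


text \<open>Since \<open>m\<close> is even, a step along the second factor flips the parity of that
  coordinate, so the table pulls back along \<open>r\<close> to the torus. As
  \<open>m \<noteq> 4\<close>, only direction 0 has 4-cycles inside a factor.\<close>

lemma q_B_torus_le_5:
  assumes "even m" "3 \<le> m" "m \<noteq> 4"
  shows "q_B (discrete_torus [4, m]) \<le> 5"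
proof -
  let ?ms = "[4, m]"
  define r :: "nat list \<Rightarrow> nat \<times> nat" where "r x = (x ! 0, x ! 1 mod 2)" for x
  have ms3: "\<forall>m\<in>set ?ms. 3 \<le> m" using assms by simp
  have r: "r x \<in> {..<4} \<times> {..<2}" if "list_all2 (<) x ?ms" for x
    using that by (auto simp: r_def list_all2_Cons2)
  have r_step: "r (step ?ms i x) = shift2 i (r x)" if "list_all2 (<) x ?ms" "i < 2" for i x
    using that assms(1)
    by (auto simp: r_def shift2_def list_all2_Cons2 step_def less_2_cases_iff mod_mod_cancel mod_Suc_eq)
  let ?f = "\<lambda>x i. color2 i (r x)"
  note check = color2_check[rule_format, OF r]
  show ?thesis
  proof (rule q_B_torus_le[OF ms3 B_coloring_torus_coloring[OF ms3]])
    fix x i assume x: "list_all2 (<) x ?ms" and "i < length ?ms"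
    then have i: "i < 2" by simp
    show "?f x i < 5" using check[OF x i] by blast
    show "?f x i \<noteq> ?f (step ?ms i (step ?ms i x)) i" if "?ms ! i = 4"
    proof -
      have "i = 0" using that i assms(3) by (auto simp: less_2_cases_iff)
      then show ?thesis using check[OF x i] r_step x step_in_torus[OF x] by simp
    qed
    fix j assume "j < length ?ms"
    then have j: "j < 2" by simp
    show "?f x i \<noteq> ?f (step ?ms i x) j" using check[OF x i] i j r_step[OF x] by simp
    assume "i \<noteq> j"
    then show "?f x i \<noteq> ?f x j" "?f (step ?ms j x) i \<noteq> ?f (step ?ms i x) j"
      "?f x i \<noteq> ?f (step ?ms j x) i"
      using check[OF x i] i j r_step[OF x] by simp_all
  qed
qed

text \<open>Colors below 6 serve the first three directions, and a direction
  \<open>i \<ge> 3\<close> owns \<open>2 * i\<close> and \<open>2 * i + 1\<close>. So only two low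
  directions, or a direction with itself, can clash.\<close>

lemma q_B_torus_le_double:
  assumes ms: "3 \<le> length ms" "ms ! 0 = 4" "\<forall>m\<in>set ms. even m \<and> 3 \<le> m"
    and ne4: "\<And>i. 0 < i \<Longrightarrow> i < length ms \<Longrightarrow> ms ! i \<noteq> 4"
  shows "q_B (discrete_torus ms) \<le> 2 * length ms"
proof -
  let ?d = "length ms"
  have ms3: "\<forall>m\<in>set ms. 3 \<le> m" and ev: "\<forall>m\<in>set ms. even m" using ms by auto
  define r :: "nat list \<Rightarrow> nat \<times> nat \<times> nat" where "r x = (x ! 0, x ! 1 mod 2, x ! 2 mod 2)" for x
  \<comment> \<open>\<open>t\<close> flips exactly under steps in directions from 3 on and shifts
    the low colors there; \<open>s\<close> flips under every step, so a high direction alternates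
    between its two colors.\<close>
  define t :: "nat list \<Rightarrow> nat" where "t x = (\<Sum>j\<in>{3..<?d}. x ! j) mod 2" for x
  define s :: "nat list \<Rightarrow> nat" where "s x = (\<Sum>j\<in>{..<?d}. x ! j) mod 2" for x
  define f where "f x i = (if i < 3 then (color3 i (r x) + t x) mod 6 else 2 * i + s x)" for x i
  have r: "r x \<in> {..<4} \<times> {..<2} \<times> {..<2}" if "list_all2 (<) x ms" for x
    using list_all2_nthD2[OF that, of 0] ms(1,2) by (cases "ms = []") (auto simp: r_def)
  have par: "(a + 1) mod ms ! i mod 2 = (a + 1) mod 2" if "i < ?d" for a i
    using that ev by (intro mod_mod_cancel) simp
  have r_step: "r (step ms i x) = (if i < 3 then shift3 i (r x) else r x)"
    if "list_all2 (<) x ms" "i < ?d" for i x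
  proof -
    have nth: "step ms i x ! k = (if k = i then (x ! i + 1) mod ms ! i else x ! k)" for k
      using that by (simp add: nth_step list_all2_lengthD)
    have "i < 3 \<Longrightarrow> i = 0 \<or> i = 1 \<or> i = 2" by auto
    then show ?thesis
      using par[OF that(2)] ms(2)
      by (auto simp: r_def shift3_def nth mod_Suc_eq)
  qed
  have t_step: "t (step ms i x) = (if i < 3 then t x else 1 - t x)"
    and s_step: "s (step ms i x) = 1 - s x"
    if "list_all2 (<) x ms" "i < ?d" for i x
    using parity_sum_step[OF ev that, of "{3..<?d}"] parity_sum_step[OF ev that, of "{..<?d}"] that(2)
    by (auto simp: t_def s_def mod_2_eq_odd)
  have ts: "t x < 2" "s x < 2" for x by (auto simp: t_def s_def)
  note check = color3_check[rule_format, OF r]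
  have inj6: "(a + b) mod 6 \<noteq> (a' + b) mod 6" if "a \<noteq> a'" "a < 6" "a' < 6" for a a' b :: nat
    using that cong_add_rcancel_nat[of a b a' 6] by (simp add: cong_def)
  have flip6: "(a + b) mod 6 \<noteq> (a + (1 - b)) mod 6" if "a < 6" "b < 2" for a b :: nat
    using that by (auto simp: less_2_cases_iff mod_Suc split: if_splits)
  have lt6: "color3 i (r x) < 6" if "list_all2 (<) x ms" "i < 3" for x i using check[OF that] by blast
  note V = step_in_torus
  show ?thesis
  proof (rule q_B_torus_le[OF ms3 B_coloring_torus_coloring[OF ms3]])
    fix x i assume x: "list_all2 (<) x ms" and i: "i < ?d"
    note Vi = step_in_torus[OF x i]
    have low: "f y k < 6" if "k < 3" for y k using that by (simp add: f_def)
    have high: "f y k = 2 * k + s y" if "3 \<le> k" for y k using that by (simp add: f_def)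
    show "f x i < 2 * ?d"
      using low[of i x] high[of i x] i ts[of x] ms(1) by (cases "i < 3") auto
    show "f x i \<noteq> f (step ms i (step ms i x)) i" if "ms ! i = 4"
    proof -
      have "i = 0" using that i ne4 by auto
      then show ?thesis
        using check[OF x, of 0] inj6 lt6[OF x] lt6[OF step_in_torus[OF Vi i]] ts r_step[OF x i] r_step[OF Vi i]
          t_step[OF x i] t_step[OF Vi i] by (simp add: f_def)
    qed
    fix j assume j: "j < ?d"
    note Vj = step_in_torus[OF x j]
    have distinct_dirs: "f y i \<noteq> f z j" if "i \<noteq> j" "3 \<le> i \<or> 3 \<le> j" for y z
      using that low[of i y] low[of j z] high[of i y] high[of j z] ts[of y] ts[of z]
      by (cases "i < 3"; cases "j < 3") auto
    have same_dir: "f x i \<noteq> f (step ms k x) i" if "3 \<le> i" "k < ?d" for k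
      using that s_step[OF x that(2)] ts[of x] by (simp add: high) presburger
    show "f x i \<noteq> f (step ms i x) j"
    proof (cases "i < 3 \<and> j < 3")
      case True
      then show ?thesis
        using check[OF x, of i] inj6 lt6[OF x] lt6[OF Vi] ts r_step[OF x i] t_step[OF x i]
        by (simp add: f_def)
    next
      case False
      then show ?thesis using distinct_dirs same_dir i by (cases "i = j") auto
    qed
    assume ij: "i \<noteq> j"
    show "f x i \<noteq> f x j"
    proof (cases "i < 3 \<and> j < 3")
      case True
      then show ?thesis using check[OF x, of i] ij inj6 lt6[OF x] ts by (simp add: f_def)
    next
      case False
      then show ?thesis using distinct_dirs ij by auto
    qed
    show "f (step ms j x) i \<noteq> f (step ms i x) j"
    proof (cases "i < 3 \<and> j < 3")
      case True
      then show ?thesis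
        using check[OF x, of i] ij inj6 lt6[OF Vi] lt6[OF Vj] ts r_step[OF x] t_step[OF x] i j
        by (simp add: f_def)
    next
      case False
      then show ?thesis using distinct_dirs ij by auto
    qed
    show "f x i \<noteq> f (step ms j x) i"
    proof (cases "i < 3")
      case True
      \<comment> \<open>For \<open>j \<ge> 3\<close> the table entry stays the same while the shift
        \<open>t\<close> flips, which moves the color by one modulo 6.\<close>
      then show ?thesis
        using check[OF x, of i] ij inj6 flip6[OF lt6[OF x] ts(1)] lt6[OF x] lt6[OF Vj]
        by (cases "j < 3") (simp_all add: f_def r_step[OF x j] t_step[OF x j] del: One_nat_def)
    next
      case False
      then show ?thesis using same_dir j by simp
    qed
  qed
qed

section \<open>Four colors do not suffice in dimension two\<close>

text \<open>
  \<open>E\<close> and \<open>F\<close> are the colors on two consecutive copies of \<open>C\<^sub>4\<close>, with indices modulo 4;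
  \<open>D\<close> and \<open>U\<close> are the colors of the edges leaving the copy of \<open>E\<close> on its two sides, those of
  \<open>U\<close> leading to the copy of \<open>F\<close>.
\<close>

lemma four_colors_step:
  fixes E U D F :: "nat \<Rightarrow> nat"
  assumes C: "finite C" "card C \<le> 4"
    and E4: "\<And>x. E (x + 4) = E x" and U4: "\<And>x. U (x + 4) = U x"
      and D4: "\<And>x. D (x + 4) = D x" and F4: "\<And>x. F (x + 4) = F x"
    and inC: "\<And>x. E x \<in> C" "\<And>x. U x \<in> C" "\<And>x. D x \<in> C" "\<And>x. F x \<in> C"
    and layer: "\<And>x. distinct [E x, E (x + 1), E (x + 2), E (x + 3)]"
    and vertex: "\<And>x. distinct [E x, E (x + 1), U (x + 1), D (x + 1)]"
    and square: "\<And>x. D x \<noteq> D (x + 1)" "\<And>x. distinct [E x, U x, U (x + 1), F x]"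
  shows "(\<forall>x. D x = E (x + 1) \<and> U x = E (x + 2) \<and> F x = E (x + 1)) \<or>
         (\<forall>x. D x = E (x + 2) \<and> U x = E (x + 1) \<and> F x = E (x + 3))"
proof -
  define a b c d where "a = E 0" and "b = E 1" and "c = E 2" and "d = E 3"
  have dist: "distinct [a, b, c, d]" using layer[of 0] by (simp add: a_def b_def c_def d_def numeral_eq_Suc)
  have "C = {a, b, c, d}"
    using C dist inC(1) by (intro card_seteq[symmetric]) (auto simp: a_def b_def c_def d_def)
  then have in4: "U x \<in> {a, b, c, d}" "D x \<in> {a, b, c, d}" "F x \<in> {a, b, c, d}" for x
    using inC by auto
  have E: "E 0 = a" "E 1 = b" "E 2 = c" "E 3 = d" "E 4 = a" "E 5 = b" "E 6 = c"
    using E4[of 0] E4[of 1] E4[of 2] by (simp_all add: a_def b_def c_def d_def)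
  have per: "U 4 = U 0" "D 4 = D 0" "F 4 = F 0" using U4[of 0] D4[of 0] F4[of 0] by simp_all
  \<comment> \<open>The vertex between \<open>E x\<close> and \<open>E (x + 1)\<close> has index
    \<open>x + 1\<close>, so vertex 0 comes from \<open>x = 3\<close> by periodicity.\<close>
  have v: "distinct [d, a, U 0, D 0]" "distinct [a, b, U 1, D 1]"
    "distinct [b, c, U 2, D 2]" "distinct [c, d, U 3, D 3]"
    using vertex[of 3] vertex[of 0] vertex[of 1] vertex[of 2] per E by (simp_all add: numeral_eq_Suc)
  have q: "D 0 \<noteq> D 1" "D 1 \<noteq> D 2" "D 2 \<noteq> D 3" "D 3 \<noteq> D 0"
    using square(1)[of 0] square(1)[of 1] square(1)[of 2] square(1)[of 3] per by (simp_all add: numeral_eq_Suc)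
  have p: "distinct [a, U 0, U 1, F 0]" "distinct [b, U 1, U 2, F 1]"
    "distinct [c, U 2, U 3, F 2]" "distinct [d, U 3, U 0, F 3]"
    using square(2)[of 0] square(2)[of 1] square(2)[of 2] square(2)[of 3] per E by (simp_all add: numeral_eq_Suc)
  \<comment> \<open>The layer uses two colors at each vertex; \<open>D\<close> and \<open>U\<close>
    share the other two.\<close>
  have D: "D 0 = b \<or> D 0 = c" "D 1 = c \<or> D 1 = d" "D 2 = d \<or> D 2 = a" "D 3 = a \<or> D 3 = b"
    using v in4(2)[of 0] in4(2)[of 1] in4(2)[of 2] in4(2)[of 3] by auto
  have U: "U 0 = b \<or> U 0 = c" "U 1 = c \<or> U 1 = d" "U 2 = d \<or> U 2 = a" "U 3 = a \<or> U 3 = b"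
    using v in4(1)[of 0] in4(1)[of 1] in4(1)[of 2] in4(1)[of 3] by auto
  have UD: "U 0 \<noteq> D 0" "U 1 \<noteq> D 1" "U 2 \<noteq> D 2" "U 3 \<noteq> D 3" using v by auto
  \<comment> \<open>As neighbouring values of \<open>D\<close> differ, each choice of
    \<open>D 0\<close> determines \<open>D\<close> around the cycle, then \<open>U\<close> as the
    remaining color at each vertex and \<open>F\<close> as the remaining color of each
    square.\<close>
  from D(1) have main: "(D 0 = b \<and> D 1 = c \<and> D 2 = d \<and> D 3 = a \<and> U 0 = c \<and> U 1 = d \<and> U 2 = a \<and> U 3 = b \<and>
      F 0 = b \<and> F 1 = c \<and> F 2 = d \<and> F 3 = a) \<or>
    (D 0 = c \<and> D 1 = d \<and> D 2 = a \<and> D 3 = b \<and> U 0 = b \<and> U 1 = c \<and> U 2 = d \<and> U 3 = a \<and>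
      F 0 = d \<and> F 1 = a \<and> F 2 = b \<and> F 3 = c)"
  proof
    assume D0: "D 0 = b"
    then have D': "D 3 = a" "D 2 = d" "D 1 = c" using D q by metis+
    then have U': "U 0 = c" "U 1 = d" "U 2 = a" "U 3 = b" using D0 U UD by metis+
    have F0: "F 0 = b" using p(1) in4(3)[of 0] unfolding U' by auto
    have F1: "F 1 = c" using p(2) in4(3)[of 1] unfolding U' by auto
    have F2: "F 2 = d" using p(3) in4(3)[of 2] unfolding U' by auto
    have F3: "F 3 = a" using p(4) in4(3)[of 3] unfolding U' by auto
    show ?thesis using D0 D' U' F0 F1 F2 F3 by blast
  next
    assume D0: "D 0 = c"
    then have D': "D 1 = d" "D 2 = a" "D 3 = b" using D q by metis+
    then have U': "U 0 = b" "U 1 = c" "U 2 = d" "U 3 = a" using D0 U UD by metis+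
    have F0: "F 0 = d" using p(1) in4(3)[of 0] unfolding U' by auto
    have F1: "F 1 = a" using p(2) in4(3)[of 1] unfolding U' by auto
    have F2: "F 2 = b" using p(3) in4(3)[of 2] unfolding U' by auto
    have F3: "F 3 = c" using p(4) in4(3)[of 3] unfolding U' by auto
    show ?thesis using D0 D' U' F0 F1 F2 F3 by blast
  qed
  have all: "P x" if "P 0" "P 1" "P 2" "P 3" "\<And>x. P (x + 4) = P x" for P :: "nat \<Rightarrow> bool" and x
  proof (induction x rule: less_induct)
    case (less x)
    show ?case
    proof (cases "x < 4")
      case True
      then have "x = 0 \<or> x = 1 \<or> x = 2 \<or> x = 3" by auto
      then show ?thesis using that by blast
    next
      case False
      then show ?thesis using that(5)[of "x - 4"] less[of "x - 4"] by simp
    qed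
  qed
  \<comment> \<open>The offsets of the two alternatives are 1, 2, 1 and 2, 1, 3. Period 4 reduces
    all \<open>x\<close> to the four cases in \<open>main\<close>.\<close>
  define Q where "Q j k l x \<longleftrightarrow> D x = E (x + j) \<and> U x = E (x + k) \<and> F x = E (x + l)" for j k l x
  have "Q j k l (x + 4) = Q j k l x" for j k l x
    using E4[of "x + j"] E4[of "x + k"] E4[of "x + l"] D4[of x] U4[of x] F4[of x]
    unfolding Q_def by (simp add: ac_simps)
  then have Q: "Q j k l x" if "Q j k l 0" "Q j k l 1" "Q j k l 2" "Q j k l 3" for j k l x
    using all[of "Q j k l" x] that by blast
  have E': "E (0 + 1) = b" "E (1 + 1) = c" "E (2 + 1) = d" "E (3 + 1) = a"
    "E (0 + 2) = c" "E (1 + 2) = d" "E (2 + 2) = a" "E (3 + 2) = b"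
    "E (0 + 3) = d" "E (1 + 3) = a" "E (2 + 3) = b" "E (3 + 3) = c"
    using E by (simp_all add: numeral_eq_Suc)
  from main have "(Q 1 2 1 0 \<and> Q 1 2 1 1 \<and> Q 1 2 1 2 \<and> Q 1 2 1 3) \<or> (Q 2 1 3 0 \<and> Q 2 1 3 1 \<and> Q 2 1 3 2 \<and> Q 2 1 3 3)"
    unfolding Q_def E' by blast
  then show ?thesis using Q[of 1 2 1] Q[of 2 1 3] unfolding Q_def by blast
qed

text \<open>With four colors, going once around the second factor shifts a layer by
  \<open>m * k\<close> places, where \<open>k\<close> is 1 or 3. This is 2 modulo 4, so opposite
  edges of that layer would get the same color.\<close>

lemma q_B_torus_ge_5:
  assumes m: "3 \<le> m" "m mod 4 = 2"
  shows "5 \<le> q_B (discrete_torus [4, m])"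
proof (rule ccontr)
  let ?T = "discrete_torus [4, m]"
  have ms3: "\<forall>k\<in>set [4, m]. 3 \<le> k" using m by simp
  have simple: "simple_graph ?T" using m by (intro simple_graph_discrete_torus) auto
  assume "\<not> 5 \<le> q_B ?T"
  then obtain c :: "nat list set \<Rightarrow> nat" where c: "B_coloring ?T c" "card (c ` edges ?T) \<le> 4"
    using q_B_attained[OF simple] by force
  define C where "C = c ` edges ?T"
  \<comment> \<open>Reducing both coordinates lets all natural numbers serve as indices, so
    wrap-around needs no separate cases.\<close>
  define v where "v x j = [x mod 4, j mod m]" for x j
  define e where "e j x = c {v x j, v (x + 1) j}" for j x
  define u where "u j x = c {v x j, v x (j + 1)}" for j x
  have v4: "v (x + 4) j = v x j" and vm: "v x (j + m) = v x j" for x j by (simp_all add: v_def)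
  have edge: "{v x j, v (x + 1) j} \<in> edges ?T" "{v x j, v x (j + 1)} \<in> edges ?T" for x j
  proof -
    have V: "list_all2 (<) (v x j) [4, m]" using m by (simp add: v_def)
    have E: "{v x j, step [4, m] i (v x j)} \<in> edges ?T" if "i < length [4, m]" for i
      unfolding edges_torus_iff[OF ms3] using V that by blast
    have "v (x + 1) j = step [4, m] 0 (v x j)" "v x (j + 1) = step [4, m] 1 (v x j)"
      by (simp_all add: v_def step_def mod_Suc_eq)
    then show "{v x j, v (x + 1) j} \<in> edges ?T" "{v x j, v x (j + 1)} \<in> edges ?T"
      using E[of 0] E[of 1] by simp_all
  qed
  have edge': "{v (x + 1) j, v x j} \<in> edges ?T" "{v x (j + 1), v x j} \<in> edges ?T" for x j
    using edge[of x j] by (simp_all only: insert_commute)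
  have star: "c {p, q} \<noteq> c {p, r}" if "{p, q} \<in> edges ?T" "{p, r} \<in> edges ?T" "q \<noteq> r" for p q r
  proof -
    have "{p, q} \<noteq> {p, r} \<and> {p, q} \<inter> {p, r} \<noteq> {}" using that(3) by (auto simp: doubleton_eq_iff)
    moreover have "proper_edge_coloring ?T c" using c(1) by (simp add: B_coloring_def)
    ultimately show ?thesis
      using that(1,2) unfolding proper_edge_coloring_def by simp
  qed
  have opp: "c {p, q} \<noteq> c {r, s}"
    if "distinct [p, q, r, s]" "{p, q} \<in> edges ?T" "{q, r} \<in> edges ?T" "{r, s} \<in> edges ?T" "{s, p} \<in> edges ?T"
    for p q r s
  proof
    let ?F = "{{p, q}, {q, r}, {r, s}, {s, p}}"
    assume eq: "c {p, q} = c {r, s}"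
    have rb: "inj_on c F" if "is_four_cycle ?T F" for F
      using c(1) that by (simp add: B_coloring_def rainbow_def)
    have "?F \<subseteq> edges ?T" using that(2-5) by simp
    then have "is_four_cycle ?T ?F" using that(1) unfolding is_four_cycle_def
      by (intro exI[of _ p] exI[of _ q] exI[of _ r] exI[of _ s] conjI refl)
    then have "inj_on c ?F" by (rule rb)
    then have "{p, q} = {r, s}" using eq by (rule inj_onD) (simp_all only: insert_iff simp_thms)
    then show False using that(1) unfolding doubleton_eq_iff by simp
  qed
  have ne: "(j + k) mod m \<noteq> j mod m" if "0 < k" "k < m" for j k
  proof
    assume "(j + k) mod m = j mod m"
    then have "m dvd k" using mod_eq_dvd_iff_nat[of j "j + k" m] by simp
    then show False using that dvd_imp_le by fastforce
  qed
  have ne4: "x mod 4 \<noteq> (x + 1) mod 4" "x mod 4 \<noteq> (x + 2) mod 4" "x mod 4 \<noteq> (x + 3) mod 4" for x :: nat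
    by presburger+
  have v_ne: "v x j \<noteq> v (x + 1) k" "v x j \<noteq> v (x + 2) k" "v x j \<noteq> v (x + 3) k"
    "v x j \<noteq> v y (j + 1)" "v x j \<noteq> v y (j + 2)" for x y j k
    using ne4[of x] ne[of 1 j] ne[of 2 j] m(1) by (auto simp: v_def)
  have e': "e j x = c {v (x + 1) j, v x j}" and u': "u j x = c {v x (j + 1), v x j}" for j x
    by (simp_all only: e_def u_def insert_commute)
  have assoc: "x + 1 + 1 = x + (2 :: nat)" "x + 1 + 2 = x + (3 :: nat)" "x + 2 + 1 = x + (3 :: nat)"
    "x + 2 + 2 = x + (4 :: nat)" "x + 3 + 1 = x + (4 :: nat)" for x by simp_all
  have e4: "e j (x + 4) = e j x" and u4: "u j (x + 4) = u j x" for j x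
    using v4[of "x + 1" j] v4[of x] by (simp_all add: e_def u_def ac_simps)
  have path: "e j x \<noteq> e j (x + 1)" "u j x \<noteq> u (j + 1) x" for j x
    using star[OF edge'(1)[of x j] edge(1)[of "x + 1" j]] v_ne(2)[of x j j]
      star[OF edge'(2)[of x j] edge(2)[of x "j + 1"]] v_ne(5)[of x j x]
    unfolding e'[of j x] u'[of j x] e_def[of j "x + 1"] u_def[of "j + 1" x] assoc by blast+
  have corner: "e j x \<noteq> u j x" "e j x \<noteq> u j (x + 1)" "e (j + 1) x \<noteq> u j x" "e (j + 1) x \<noteq> u j (x + 1)" for j x
    using star[OF edge(1)[of x j] edge(2)[of x j]] v_ne(1)[of x "j + 1" j] v_ne(1)[of x j "j + 1"]
      star[OF edge'(1)[of x j] edge(2)[of "x + 1" j]]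
      star[OF edge(1)[of x "j + 1"] edge'(2)[of x j]]
      star[OF edge'(1)[of x "j + 1"] edge'(2)[of "x + 1" j]]
    unfolding e_def u_def e'[symmetric, unfolded e_def] u'[symmetric, unfolded u_def] by metis+
  have square: "u j x \<noteq> u j (x + 1)" "e j x \<noteq> e (j + 1) x" for j x
  proof -
    have d: "distinct [v x j, v (x + 1) j, v (x + 1) (j + 1), v x (j + 1)]"
      using v_ne(1)[of x] v_ne(4)[of x j] v_ne(4)[of "x + 1" j] by simp metis
    then show "e j x \<noteq> e (j + 1) x"
      using opp[OF d edge(1) edge(2) edge'(1) edge'(2)] unfolding e_def[of j] e'[of "j + 1"] by blast
    have "distinct [v x (j + 1), v x j, v (x + 1) j, v (x + 1) (j + 1)]" using d by auto
    from opp[OF this edge'(2) edge(1) edge(2) edge'(1)] show "u j x \<noteq> u j (x + 1)"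
      unfolding u'[of j x] u_def[of j "x + 1"] by blast
  qed
  have layer: "e j x \<noteq> e j (x + 2)" for j x
  proof -
    have "distinct [v x j, v (x + 1) j, v (x + 2) j, v (x + 3) j]"
      using v_ne(1-3)[of x j j] v_ne(1,2)[of "x + 1" j j] v_ne(1)[of "x + 2" j j] unfolding assoc by simp
    from opp[OF this] show ?thesis
      using edge(1)[of x j] edge(1)[of "x + 1" j] edge(1)[of "x + 2" j] edge(1)[of "x + 3" j]
      unfolding assoc v4 e_def by blast
  qed
  \<comment> \<open>The middle layer is \<open>j + 1\<close>, so that the layer before it also has a
    natural number as index; \<open>u j\<close>, \<open>u (j + 1)\<close> and
    \<open>e (j + 2)\<close> take the roles of \<open>D\<close>, \<open>U\<close> and
    \<open>F\<close>.\<close>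
  have local_structure:
    "(\<forall>x. u j x = e (j + 1) (x + 1) \<and> u (j + 1) x = e (j + 1) (x + 2) \<and> e (j + 2) x = e (j + 1) (x + 1)) \<or>
     (\<forall>x. u j x = e (j + 1) (x + 2) \<and> u (j + 1) x = e (j + 1) (x + 1) \<and> e (j + 2) x = e (j + 1) (x + 3))" for j
  proof (rule four_colors_step[of C])
    show "finite C" "card C \<le> 4" using c simple_graph_finite_edges[OF simple] by (auto simp: C_def)
    show "e (j + 1) (x + 4) = e (j + 1) x" "u (j + 1) (x + 4) = u (j + 1) x" "u j (x + 4) = u j x"
      "e (j + 2) (x + 4) = e (j + 2) x" for x
      by (rule e4 u4)+
    show "e (j + 1) x \<in> C" "u (j + 1) x \<in> C" "u j x \<in> C" "e (j + 2) x \<in> C" for x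
      using edge unfolding C_def e_def u_def by blast+
    show "distinct [e (j + 1) x, e (j + 1) (x + 1), e (j + 1) (x + 2), e (j + 1) (x + 3)]" for x
      using path(1)[of "j + 1" x] path(1)[of "j + 1" "x + 1"] path(1)[of "j + 1" "x + 2"]
        path(1)[of "j + 1" "x + 3"] layer[of "j + 1" x] layer[of "j + 1" "x + 1"]
      unfolding assoc e4 by simp
    show "distinct [e (j + 1) x, e (j + 1) (x + 1), u (j + 1) (x + 1), u j (x + 1)]" for x
      using path(1)[of "j + 1" x] path(2)[of j "x + 1"] corner(2)[of "j + 1" x] corner(4)[of j x]
        corner(1)[of "j + 1" "x + 1"] corner(3)[of j "x + 1"] by simp
    show "u j x \<noteq> u j (x + 1)" for x by (rule square)
    show "distinct [e (j + 1) x, u (j + 1) x, u (j + 1) (x + 1), e (j + 2) x]" for x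
      using corner[of "j + 1" x] square[of "j + 1" x] unfolding assoc by simp
  qed
  \<comment> \<open>The two alternatives are recorded on the edges entering layer
    \<open>j + 1\<close>. The edges leaving it decide the alternative at the next layer, so the
    direction of rotation persists.\<close>
  define A B where "A j \<longleftrightarrow> (\<forall>x. u j x = e (j + 1) (x + 1))"
    and "B j \<longleftrightarrow> (\<forall>x. u j x = e (j + 1) (x + 2))" for j
  have AB: "A j \<Longrightarrow> \<not> B j" for j
    using path(1)[of "j + 1" "0 + 1"] unfolding A_def B_def assoc by metis
  have A: "A (j + 1)" "e (j + 2) x = e (j + 1) (x + 1)" if "A j" for j x
  proof -
    have *: "u (j + 1) x = e (j + 1) (x + 2)" "e (j + 2) x = e (j + 1) (x + 1)" for x
      using local_structure[of j] AB[OF that] unfolding B_def by blast+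
    show "e (j + 2) x = e (j + 1) (x + 1)" by (rule *)
    \<comment> \<open>\<open>u (j + 1) x\<close> equals \<open>e (j + 1) (x + 2)\<close>, which by
      the rotation is \<open>e (j + 2) (x + 1)\<close>.\<close>
    show "A (j + 1)" unfolding A_def assoc *(2) unfolding *(1) assoc by simp
  qed
  have B: "B (j + 1)" "e (j + 2) x = e (j + 1) (x + 3)" if "B j" for j x
  proof -
    have *: "u (j + 1) x = e (j + 1) (x + 1)" "e (j + 2) x = e (j + 1) (x + 3)" for x
      using local_structure[of j] AB[of j] that unfolding A_def by blast+
    show "e (j + 2) x = e (j + 1) (x + 3)" by (rule *)
    \<comment> \<open>\<open>e (j + 2) (x + 2)\<close> is \<open>e (j + 1) (x + 5)\<close>, and 5
      counts as 1 modulo 4.\<close>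
    have "x + 2 + 3 = x + 1 + 4" for x :: nat by simp
    then show "B (j + 1)" unfolding B_def assoc *(2) unfolding *(1) using e4 by metis
  qed
  have "A 0 \<or> B 0" using local_structure[of 0] unfolding A_def B_def by blast
  then have "\<exists>k. (k = 1 \<or> k = 3) \<and> (\<forall>j x. e (j + 2) x = e (j + 1) (x + k))"
  proof
    assume "A 0"
    then have "A j" for j using A(1) by (induction j) simp_all
    then show ?thesis using A(2) by blast
  next
    assume "B 0"
    then have "B j" for j using B(1) by (induction j) simp_all
    then show ?thesis using B(2) by blast
  qed
  then obtain k where k: "k = 1 \<or> k = 3" "\<And>j x. e (j + 2) x = e (j + 1) (x + k)" by blast
  \<comment> \<open>The recurrence relates layers from 1 on, so the base is layer 1, with which
    layer \<open>m + 1\<close> coincides.\<close>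
  have "e (j + 1) x = e 1 (x + j * k)" for j x
  proof (induction j arbitrary: x)
    case (Suc j)
    then show ?case using k(2)[of j x] Suc[of "x + k"] by (simp add: ac_simps)
  qed simp
  moreover have "e (m + 1) x = e 1 x" for x
    unfolding e_def using vm[of _ 1] by (simp add: ac_simps)
  ultimately have "e 1 0 = e 1 (m * k)" by (metis add_0)
  moreover have "e 1 (x + 4 * q) = e 1 x" for x q
  proof (induction q)
    case (Suc q)
    then show ?case using e4[of 1 "x + 4 * q"] by (simp add: ac_simps)
  qed simp
  \<comment> \<open>Since \<open>k\<close> is odd, a rotation in either direction ends at the
    opposite edge.\<close>
  moreover have "\<exists>q. m * k = 2 + 4 * q"
  proof -
    have "(m * k) mod 4 = 2" using k(1) m(2) mod_mult_left_eq[of m 4 k] by auto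
    then have "m * k = 2 + 4 * (m * k div 4)" by presburger
    then show ?thesis by blast
  qed
  ultimately show False using layer[of 1 0] by (metis add_0)
qed

section \<open>The exceptional tori\<close>

text \<open>The four edges form a single 4-cycle, so every B-coloring is injective on them.\<close>

lemma q_B_torus_4: "q_B (discrete_torus [4]) = 4"
proof -
  let ?T = "discrete_torus [4]" and ?v = "\<lambda>k. [k :: nat]"
  let ?F = "{{?v 0, ?v 1}, {?v 1, ?v 2}, {?v 2, ?v 3}, {?v 3, ?v 0}}"
  have less4: "p < 4 \<longleftrightarrow> p = 0 \<or> p = 1 \<or> p = 2 \<or> p = 3" for p :: nat by auto
  have "edges ?T = {{?v p, ?v ((p + 1) mod 4)} | p. p < 4}"
    by (subst edges_torus) (auto simp: list_all2_Cons2 step_def)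
  also have "\<dots> = (\<lambda>p. {?v p, ?v ((p + 1) mod 4)}) ` {0, 1, 2, 3}"
    unfolding less4 by blast
  also have "\<dots> = ?F"
  proof -
    have "(0 + 1) mod 4 = (1 :: nat)" "(1 + 1) mod 4 = (2 :: nat)"
      "(2 + 1) mod 4 = (3 :: nat)" "(3 + 1) mod 4 = (0 :: nat)" by simp_all
    then show ?thesis by (simp only: image_insert image_empty)
  qed
  finally have edges: "edges ?T = ?F" .
  have "simple_graph ?T" by (rule simple_graph_discrete_torus) simp
  then obtain c :: "nat list set \<Rightarrow> nat" where c: "B_coloring ?T c" "card (c ` edges ?T) = q_B ?T"
    using q_B_attained by blast
  have "is_four_cycle ?T ?F"
    unfolding is_four_cycle_def edges
    by (intro exI[of _ "?v 0"] exI[of _ "?v 1"] exI[of _ "?v 2"] exI[of _ "?v 3"]) simp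
  then have "inj_on c ?F" using c(1) by (simp only: B_coloring_def rainbow_def)
  then have "card (c ` ?F) = card ?F" by (rule card_image)
  then have "q_B ?T = card ?F" using c(2) edges by simp
  also have "card ?F = 4" by (simp add: doubleton_eq_iff)
  finally show ?thesis .
qed

theorem theorem1p6:
  fixes d :: nat and n :: "nat \<Rightarrow> nat"
  assumes "d \<ge> 1"
    and "\<forall>i\<in>{1..d}. n i \<ge> 2"
    and "\<forall>i\<in>{1..<d}. 2 * n i \<le> 2 * n (i + 1)"
    and "exceptional d n"
  shows "q_B (even_torus d n) = (if d = 1 then 4 else if d = 2 then 5 else 2 * d)"
proof -
  define ms where "ms = map (\<lambda>i. 2 * n i) [1..<d + 1]"
  have torus: "even_torus d n = discrete_torus ms" by (simp add: even_torus_def ms_def)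
  have len: "length ms = d" by (simp add: ms_def)
  have nth: "ms ! k = 2 * n (k + 1)" if "k < d" for k
    using that unfolding ms_def by (subst nth_map) (simp_all del: upt_Suc)
  have n1: "n 1 = 2" using assms(4) by (simp add: exceptional_def)
  have mod4: "ms ! k mod 4 = 2" if "0 < k" "k < d" for k
    using assms(4) that nth[of k] by (simp add: exceptional_def cong_def)
  have ms0: "ms ! 0 = 4" using nth[of 0] n1 assms(1) by simp
  have ms: "\<forall>m\<in>set ms. even m \<and> 3 \<le> m"
  proof
    fix m assume "m \<in> set ms"
    then obtain k where k: "k < d" "m = ms ! k" unfolding len[symmetric] by (auto simp: in_set_conv_nth)
    then have "2 \<le> n (k + 1)" using assms(2) by simp
    then show "even m \<and> 3 \<le> m" using k nth by simp
  qed
  consider "d = 1" | "d = 2" | "3 \<le> d" using assms(1) by linarith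
  then show ?thesis
  proof cases
    case 1
    then have "ms = [4]" using ms0 len by (intro nth_equalityI) simp_all
    then show ?thesis using 1 torus q_B_torus_4 by simp
  next
    case 2
    define m where "m = ms ! 1"
    have eq: "ms = [4, m]"
      using 2 ms0 len by (intro nth_equalityI) (auto simp: m_def less_2_cases_iff)
    have "m mod 4 = 2" using mod4[of 1] 2 by (simp add: m_def)
    moreover have "even m" "3 \<le> m" using ms eq by simp_all
    ultimately have "q_B (discrete_torus ms) = 5"
      unfolding eq by (intro antisym q_B_torus_le_5 q_B_torus_ge_5) auto
    then show ?thesis using 2 torus by simp
  next
    case 3
    have "q_B (discrete_torus ms) \<le> 2 * d"
      unfolding len[symmetric]
    proof (rule q_B_torus_le_double)
      \<comment> \<open>A length that is 2 modulo 4 is not 4, so the first factor is the only one of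
        length 4.\<close>
      show "ms ! i \<noteq> 4" if "0 < i" "i < length ms" for i using mod4[of i] that len by auto
    qed (use 3 len ms0 ms in auto)
    moreover have "2 * d \<le> q_B (discrete_torus ms)"
      using q_B_torus_ge[of ms] ms len by simp
    ultimately show ?thesis using 3 torus by simp
  qed
qed

end
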